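(* Let $X$ be a completely regular topological space endowed with an admissible family of open coverings $\mathcal{O}$, and let $\mathcal{H}(X)$ be the set of all nonempty closed subsets of $X$. For $\mathcal{U}\in\mathcal{O}$ put $$D_{\mathcal{U}}=\bigcup\left\{ \mathrm{B}_{H}(A,\mathcal{U})\times \mathrm{B}_{H}(A,\mathcal{U}) : A\in\mathcal{H}(X)\right\}\subset \mathcal{H}(X)\times\mathcal{H}(X).$$ Then the collection of the sets $D_{\mathcal{U}}$, for $\mathcal{U}\in\mathcal{O}$, is a base for a diagonal uniformity on $\mathcal{H}(X)$.
   Context: For coverings $\mathcal{U},\mathcal{V}$ of $X$, $\mathcal{V}\leqslant\frac12\mathcal{U}$ means: for all $V,V'\in\mathcal{V}$ with $V\cap V'\neq\emptyset$ there is $U\in\mathcal{U}$ with $V\cup V'\subset U$. For $Y\subset X$, the star is $\mathrm{St}[Y,\mathcal{U}]=\bigcup\{U\in\mathcal{U}: Y\cap U\neq\emptyset\}$, and $\mathrm{St}[x,\mathcal{U}]=\mathrm{St}[\{x\},\mathcal{U}]$. A family $\mathcal{O}$ of open coverings of $X$ is admissible if (1) for any $\mathcal{U},\mathcal{V}\in\mathcal{O}$ there is $\mathcal{W}\in\mathcal{O}$ with $\mathcal{W}\leqslant\frac12\mathcal{U}$ and $\mathcal{W}\leqslant\frac12\mathcal{V}$; and (2) the stars $\mathrm{St}[x,\mathcal{U}]$, $x\in X$, $\mathcal{U}\in\mathcal{O}$, form a basis for the topology of $X$. For $A\in\mathcal{H}(X)$ and $\mathcal{U}\in\mathcal{O}$,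 $\mathrm{B}_{H}(A,\mathcal{U})=\{B\in\mathcal{H}(X): A\subset\mathrm{St}[B,\mathcal{U}]\text{ and }B\subset\mathrm{St}[A,\mathcal{U}]\}$. A diagonal uniformity is a uniformity in the sense of entourages (surroundings). *)

theory Defs
  imports "HOL-Analysis.Analysis"
begin

definition open_covering :: "'a topology \<Rightarrow> 'a set set \<Rightarrow> bool" where
  "open_covering X \<U> \<longleftrightarrow> (\<forall>U\<in>\<U>. openin X U) \<and> \<Union>\<U> = topspace X"

(* half_refines V U renders V <= (1/2) U. *)
definition half_refines :: "'a set set \<Rightarrow> 'a set set \<Rightarrow> bool" where
  "half_refines \<V> \<U> \<longleftrightarrow>
     (\<forall>V\<in>\<V>. \<forall>V'\<in>\<V>. V \<inter> V' \<noteq> {} \<longrightarrow> (\<exists>U\<in>\<U>. V \<union> V' \<subseteq> U))"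

definition star :: "'a set \<Rightarrow> 'a set set \<Rightarrow> 'a set" where
  "star Y \<U> = \<Union>{U \<in> \<U>. Y \<inter> U \<noteq> {}}"

(* The last conjunct says that the stars of points form a basis: the open sets
   are exactly the arbitrary unions of such stars. *)
definition admissible :: "'a topology \<Rightarrow> 'a set set set \<Rightarrow> bool" where
  "admissible X \<O> \<longleftrightarrow>
     (\<forall>\<U>\<in>\<O>. open_covering X \<U>) \<and>
     (\<forall>\<U>\<in>\<O>. \<forall>\<V>\<in>\<O>. \<exists>\<W>\<in>\<O>. half_refines \<W> \<U> \<and> half_refines \<W> \<V>) \<and>
     openin X = arbitrary union_of (\<lambda>S. \<exists>x\<in>topspace X. \<exists>\<U>\<in>\<O>. S = star {x} \<U>)"

definition hyperspace :: "'a topology \<Rightarrow> 'a set set" where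
  "hyperspace X = {A. closedin X A \<and> A \<noteq> {}}"

definition hball :: "'a topology \<Rightarrow> 'a set \<Rightarrow> 'a set set \<Rightarrow> 'a set set" where
  "hball X A \<U> = {B \<in> hyperspace X. A \<subseteq> star B \<U> \<and> B \<subseteq> star A \<U>}"

definition hyper_entourage :: "'a topology \<Rightarrow> 'a set set \<Rightarrow> ('a set \<times> 'a set) set" where
  "hyper_entourage X \<U> = \<Union>{hball X A \<U> \<times> hball X A \<U> | A. A \<in> hyperspace X}"

(* The type class uniform_space lives on a whole type; a uniformity on a carrier
   set S is needed here.  Separation (the entourages intersect in the diagonal)
   is not required. *)
definition diagonal_uniformity :: "'b set \<Rightarrow> ('b \<times> 'b) set set \<Rightarrow> bool" where
  "diagonal_uniformity S \<D> \<longleftrightarrow>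
     \<D> \<noteq> {} \<and>
     (\<forall>D\<in>\<D>. D \<subseteq> S \<times> S \<and> Id_on S \<subseteq> D) \<and>
     (\<forall>D\<in>\<D>. \<forall>E\<in>\<D>. D \<inter> E \<in> \<D>) \<and>
     (\<forall>D\<in>\<D>. \<exists>E\<in>\<D>. E O E \<subseteq> D) \<and>
     (\<forall>D\<in>\<D>. D\<inverse> \<in> \<D>) \<and>
     (\<forall>D\<in>\<D>. \<forall>E. D \<subseteq> E \<and> E \<subseteq> S \<times> S \<longrightarrow> E \<in> \<D>)"

definition uniformity_base :: "('b \<times> 'b) set set \<Rightarrow> ('b \<times> 'b) set set \<Rightarrow> bool" where
  "uniformity_base \<B> \<D> \<longleftrightarrow> \<B> \<subseteq> \<D> \<and> (\<forall>D\<in>\<D>. \<exists>E\<in>\<B>. E \<subseteq> D)"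

(* Over a nonempty space an admissible family is automatically nonempty, so
   assuming that the family is nonempty only matters for the empty space. *)
lemma admissible_nonempty:
  assumes "admissible X \<O>" and "topspace X \<noteq> {}"
  shows "\<O> \<noteq> {}"
proof
  assume "\<O> = {}"
  then have "openin X = arbitrary union_of (\<lambda>S. False)"
    using assms(1) by (simp add: admissible_def)
  moreover have "openin X (topspace X)" by simp
  ultimately have "(arbitrary union_of (\<lambda>S. False)) (topspace X)" by metis
  then show False
    using assms(2) by (auto simp: union_of_def arbitrary_def)
qed

end

theory Submission
  imports Defs
begin

text \<open>
  The uniformity is the collection of all supersets of the sets \<open>D\<^sub>\<U>\<close> inside
  \<open>\<H>(X) \<times> \<H>(X)\<close>. The two points that are not formal both come from half-refinement.
  If \<open>\<W> \<le> \<onehalf>\<U>\<close>, every nonempty member of \<open>\<W>\<close> lies in a member of \<open>\<U>\<close>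
  (take \<open>V = V'\<close>), so stars, Hausdorff balls and the sets \<open>D\<close> shrink when passing from
  \<open>\<U>\<close> to \<open>\<W>\<close>; hence the sets \<open>D\<^sub>\<U>\<close> are downward directed. And a star of a star with
  respect to \<open>\<W>\<close> lies in one star with respect to \<open>\<U>\<close>. So two sets in a common
  \<open>\<W>\<close>-ball lie in the \<open>\<U>\<close>-balls centred at each other: the centre of the common ball
  can be replaced by one of the two sets. If \<open>(P, Q)\<close> and \<open>(Q, R)\<close> belong to \<open>D\<^sub>\<W>\<close>,
  then \<open>P\<close> and \<open>R\<close> both lie in the \<open>\<U>\<close>-ball around \<open>Q\<close>, so that
  \<open>D\<^sub>\<W> \<circ> D\<^sub>\<W> \<subseteq> D\<^sub>\<U>\<close>.
\<close>

text \<open>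
  Symmetry of the base members replaces the usual axiom that a base contains, for each
  \<open>D\<close>, some \<open>E \<subseteq> D\<inverse>\<close>.
\<close>

lemma symmetric_base_generates_uniformity:
  assumes "\<B> \<noteq> {}"
    and entourage: "\<And>D. D \<in> \<B> \<Longrightarrow> D \<subseteq> S \<times> S \<and> Id_on S \<subseteq> D"
    and directed: "\<And>D E. D \<in> \<B> \<Longrightarrow> E \<in> \<B> \<Longrightarrow> \<exists>F\<in>\<B>. F \<subseteq> D \<inter> E"
    and comp: "\<And>D. D \<in> \<B> \<Longrightarrow> \<exists>E\<in>\<B>. E O E \<subseteq> D"
    and symm: "\<And>D. D \<in> \<B> \<Longrightarrow> D\<inverse> = D"
  shows "\<exists>\<D>. diagonal_uniformity S \<D> \<and> uniformity_base \<B> \<D>"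
proof -
  define \<D> where "\<D> = {D. D \<subseteq> S \<times> S \<and> (\<exists>E\<in>\<B>. E \<subseteq> D)}"
  have base: "\<B> \<subseteq> \<D>"
    unfolding \<D>_def using entourage by blast
  have "D \<inter> E \<in> \<D>" if DE: "D \<in> \<D>" "E \<in> \<D>" for D E
  proof -
    obtain D' E' where sub: "D' \<in> \<B>" "D' \<subseteq> D" "E' \<in> \<B>" "E' \<subseteq> E"
      using DE unfolding \<D>_def by blast
    obtain F where "F \<in> \<B>" "F \<subseteq> D' \<inter> E'"
      using directed[OF sub(1,3)] by blast
    with sub have "F \<in> \<B>" "F \<subseteq> D \<inter> E"
      by blast+
    with DE show ?thesis
      unfolding \<D>_def by blast
  qed
  moreover have "\<exists>E\<in>\<D>. E O E \<subseteq> D" if D: "D \<in> \<D>" for D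
  proof -
    obtain D' where "D' \<in> \<B>" "D' \<subseteq> D"
      using D unfolding \<D>_def by blast
    moreover from this obtain E where "E \<in> \<B>" "E O E \<subseteq> D'"
      using comp by blast
    ultimately have "E \<in> \<D>" "E O E \<subseteq> D"
      using base by blast+
    then show ?thesis ..
  qed
  moreover have "D\<inverse> \<in> \<D>" if D: "D \<in> \<D>" for D
  proof -
    obtain E where E: "E \<in> \<B>" "E \<subseteq> D" and sub: "D \<subseteq> S \<times> S"
      using D unfolding \<D>_def by blast
    then have "E \<subseteq> D\<inverse>"
      using symm[of E] by blast
    with E sub show ?thesis
      unfolding \<D>_def by blast
  qed
  moreover have "D \<subseteq> S \<times> S \<and> Id_on S \<subseteq> D" if D: "D \<in> \<D>" for D
  proof -
    obtain E where "E \<in> \<B>" "E \<subseteq> D" "D \<subseteq> S \<times> S"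
      using D unfolding \<D>_def by blast
    with entourage[of E] show ?thesis
      by blast
  qed
  moreover have "E \<in> \<D>" if "D \<in> \<D>" "D \<subseteq> E" "E \<subseteq> S \<times> S" for D E
    using that unfolding \<D>_def by blast
  moreover have "\<D> \<noteq> {}"
    using \<open>\<B> \<noteq> {}\<close> base by blast
  ultimately have "diagonal_uniformity S \<D>"
    unfolding diagonal_uniformity_def by simp
  moreover have "uniformity_base \<B> \<D>"
    unfolding uniformity_base_def using base unfolding \<D>_def by blast
  ultimately show ?thesis
    by (intro exI conjI)
qed

lemma subset_star: "open_covering X \<U> \<Longrightarrow> Y \<subseteq> topspace X \<Longrightarrow> Y \<subseteq> star Y \<U>"
  unfolding open_covering_def star_def by blast

lemma star_mono: "Y \<subseteq> Z \<Longrightarrow> star Y \<U> \<subseteq> star Z \<U>"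
  unfolding star_def by blast

text \<open>
  Half-refinement says nothing about an empty member of \<open>\<W>\<close>, but such a member
  contributes no point to a star.
\<close>

lemma star_half_refines:
  assumes "half_refines \<W> \<U>"
  shows "star Y \<W> \<subseteq> star Y \<U>"
proof
  fix x assume "x \<in> star Y \<W>"
  then obtain W where "W \<in> \<W>" "Y \<inter> W \<noteq> {}" "x \<in> W"
    unfolding star_def by blast
  moreover from this obtain U where "U \<in> \<U>" "W \<union> W \<subseteq> U"
    using assms unfolding half_refines_def by blast
  ultimately show "x \<in> star Y \<U>"
    unfolding star_def by blast
qed

text \<open>
  A point of the iterated star is joined to \<open>Y\<close> by a chain of two intersecting members
  of \<open>\<W>\<close>, and the union of such a chain fits into one member of \<open>\<U>\<close>.
\<close>

lemma star_star_half_refines: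
  assumes "half_refines \<W> \<U>"
  shows "star (star Y \<W>) \<W> \<subseteq> star Y \<U>"
proof
  fix x assume "x \<in> star (star Y \<W>) \<W>"
  then obtain V W where "V \<in> \<W>" "x \<in> V" "W \<in> \<W>" "Y \<inter> W \<noteq> {}" "V \<inter> W \<noteq> {}"
    unfolding star_def by blast
  moreover from this obtain U where "U \<in> \<U>" "V \<union> W \<subseteq> U"
    using assms unfolding half_refines_def by blast
  ultimately show "x \<in> star Y \<U>"
    unfolding star_def by blast
qed

lemma hball_half_refines: "half_refines \<W> \<U> \<Longrightarrow> hball X A \<W> \<subseteq> hball X A \<U>"
  unfolding hball_def using star_half_refines by blast

lemma hyper_entourage_iff:
  "(P, Q) \<in> hyper_entourage X \<U> \<longleftrightarrow>
     (\<exists>A\<in>hyperspace X. P \<in> hball X A \<U> \<and> Q \<in> hball X A \<U>)"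
  unfolding hyper_entourage_def by blast

lemma hyper_entourage_half_refines:
  "half_refines \<W> \<U> \<Longrightarrow> hyper_entourage X \<W> \<subseteq> hyper_entourage X \<U>"
  using hball_half_refines[of \<W> \<U> X] unfolding hyper_entourage_def by blast

lemma hball_centre: "open_covering X \<U> \<Longrightarrow> A \<in> hyperspace X \<Longrightarrow> A \<in> hball X A \<U>"
  by (simp add: hball_def hyperspace_def subset_star closedin_subset)

lemma hyper_entourage_subset: "hyper_entourage X \<U> \<subseteq> hyperspace X \<times> hyperspace X"
  unfolding hyper_entourage_def hball_def by blast

lemma converse_hyper_entourage: "(hyper_entourage X \<U>)\<inverse> = hyper_entourage X \<U>"
  by (auto simp: hyper_entourage_iff)

text \<open>
  The auxiliary centre of a common ball is eliminated by passing through it: each of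
  \<open>P\<close> and \<open>Q\<close> is in the star of the centre, which is in the star of the other.
\<close>

lemma hyper_entourage_recentre:
  assumes "half_refines \<W> \<U>" and "(P, Q) \<in> hyper_entourage X \<W>"
  shows "P \<in> hball X Q \<U>"
proof -
  obtain A where P: "P \<in> hball X A \<W>" and Q: "Q \<in> hball X A \<W>"
    using assms(2) by (auto simp: hyper_entourage_iff)
  have "P \<subseteq> star (star Q \<W>) \<W>" and "Q \<subseteq> star (star P \<W>) \<W>"
    using P Q star_mono[of A] unfolding hball_def by blast+
  then have "P \<subseteq> star Q \<U>" and "Q \<subseteq> star P \<U>"
    using star_star_half_refines[OF assms(1)] by blast+
  then show ?thesis
    using P unfolding hball_def by blast
qed

lemma hyper_entourage_comp:
  assumes "half_refines \<W> \<U>"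
  shows "hyper_entourage X \<W> O hyper_entourage X \<W> \<subseteq> hyper_entourage X \<U>"
proof
  fix z assume "z \<in> hyper_entourage X \<W> O hyper_entourage X \<W>"
  then obtain P Q R where z: "z = (P, R)"
    and PQ: "(P, Q) \<in> hyper_entourage X \<W>" and QR: "(Q, R) \<in> hyper_entourage X \<W>"
    by blast
  have "(R, Q) \<in> hyper_entourage X \<W>"
    using QR converse_hyper_entourage by blast
  then have "P \<in> hball X Q \<U>" and "R \<in> hball X Q \<U>"
    using PQ hyper_entourage_recentre[OF assms] by blast+
  moreover have "Q \<in> hyperspace X"
    using PQ hyper_entourage_subset by blast
  ultimately show "z \<in> hyper_entourage X \<U>"
    unfolding z hyper_entourage_iff by blast
qed

theorem theorem2:
  fixes X :: "'a topology" and \<O> :: "'a set set set"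
  assumes "completely_regular_space X"
    and "admissible X \<O>"
    and "\<O> \<noteq> {}"
  shows "\<exists>\<D>. diagonal_uniformity (hyperspace X) \<D> \<and>
             uniformity_base {hyper_entourage X \<U> | \<U>. \<U> \<in> \<O>} \<D>"
proof (rule symmetric_base_generates_uniformity)
  have covering: "open_covering X \<U>" if "\<U> \<in> \<O>" for \<U>
    using assms(2) that by (simp add: admissible_def)
  have refinement: "\<exists>\<W>\<in>\<O>. half_refines \<W> \<U> \<and> half_refines \<W> \<V>"
    if "\<U> \<in> \<O>" "\<V> \<in> \<O>" for \<U> \<V>
    using assms(2) that by (simp add: admissible_def)
  let ?\<B> = "{hyper_entourage X \<U> | \<U>. \<U> \<in> \<O>}"
  show "?\<B> \<noteq> {}"
    using assms(3) by blast
  show "D \<subseteq> hyperspace X \<times> hyperspace X \<and> Id_on (hyperspace X) \<subseteq> D" if D: "D \<in> ?\<B>" for D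
  proof -
    obtain \<U> where "\<U> \<in> \<O>" and D: "D = hyper_entourage X \<U>"
      using D by blast
    then have "(A, A) \<in> D" if "A \<in> hyperspace X" for A
      using that hball_centre[OF covering] by (auto simp: hyper_entourage_iff)
    then show ?thesis
      unfolding D using hyper_entourage_subset by blast
  qed
  show "\<exists>F\<in>?\<B>. F \<subseteq> D \<inter> E" if "D \<in> ?\<B>" "E \<in> ?\<B>" for D E
  proof -
    obtain \<U> \<V> where "\<U> \<in> \<O>" "\<V> \<in> \<O>"
      and DE: "D = hyper_entourage X \<U>" "E = hyper_entourage X \<V>"
      using \<open>D \<in> ?\<B>\<close> \<open>E \<in> ?\<B>\<close> by blast
    with refinement obtain \<W> where "\<W> \<in> \<O>" "half_refines \<W> \<U>" "half_refines \<W> \<V>"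
      by blast
    then have "hyper_entourage X \<W> \<subseteq> D \<inter> E"
      unfolding DE using hyper_entourage_half_refines by blast
    with \<open>\<W> \<in> \<O>\<close> show ?thesis
      by blast
  qed
  show "\<exists>E\<in>?\<B>. E O E \<subseteq> D" if "D \<in> ?\<B>" for D
  proof -
    obtain \<U> where "\<U> \<in> \<O>" and D: "D = hyper_entourage X \<U>"
      using \<open>D \<in> ?\<B>\<close> by blast
    with refinement obtain \<W> where "\<W> \<in> \<O>" "half_refines \<W> \<U>"
      by blast
    then have "hyper_entourage X \<W> O hyper_entourage X \<W> \<subseteq> D"
      unfolding D using hyper_entourage_comp by blast
    with \<open>\<W> \<in> \<O>\<close> show ?thesis
      by blast
  qed
  show "D\<inverse> = D" if "D \<in> ?\<B>" for D
    using that converse_hyper_entourage by blast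
qed

end
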